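(* Let $\|\cdot\|_T$ (truck metric) and $\|\cdot\|_D$ (drone metric) be norms on $\mathbb{R}^2$, and suppose the drone metric is no larger than the truck metric, i.e. $\|p\|_D\le\|p\|_T$ for all $p\in\mathbb{R}^2$. For any given TSPD, there exists an optimal solution without any straight rings.
   Context: Traveling Salesman Problem with Drone (TSPD). Let $\|\cdot\|_T$ (truck metric) and $\|\cdot\|_D$ (drone metric) be norms on $\mathbb{R}^2$, and let $\mathcal X\subset\mathbb{R}^2$ be a finite set of customer points (nodes). In a solution each node is exactly one of: a truck node (visited only by the truck), a drone node (served only by the drone), or a combined node (visited by both vehicles; a synchronization point). A ring $r$ is given by two distinct combined nodes serving as start and end nodes, together with at most one drone node and any number (possibly zero) of truck nodes between them. In ring $r$ the truck follows a path $\mathcal T_r$ from the start node through all truck nodes of the ring (in some order) to the end node, and, if a drone node is present, the drone follows the path $\mathcal D_r$ from the start node to the drone node to the end node. With $t(\mathcal T_r)$ the sum of the $\|\cdot\|_T$-lengths of the edges of $\mathcal T_r$ and $d(\mathcal D_r)$ the sum of the $\|\cdot\|_D$-lengths of the edges of $\mathcal D_r$, the cost $c(r)$ of the ring is the minimum, over the choices of $\mathcal T_r,\mathcal D_r$, of $\max\{t(\mathcal T_r),d(\mathcal D_r)\}$ if the ring contains a drone node, and of $t(\mathcal T_r)$ otherwise. A feasible solution for $\mathcal X$ is a set $\mathcal R(\mathcal X)$ of rings that together cover all points of $\mathcal X$ and are concatenated through their combined nodes to form a single cyclic tour; each point of $\mathcal X$ is served exactly once: a combined node is shared by exactly two adjacent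 rings, and every other point belongs to exactly one ring. The optimal makespan is $\mathsf{TSPD}(\mathcal X)=\min_{\mathcal R(\mathcal X)}\sum_{r\in\mathcal R(\mathcal X)}c(r)$; an optimal solution is a feasible solution attaining this minimum. Conventions: $\mathsf{TSPD}(\mathcal X)=0$ if $|\mathcal X|\le1$, and $\mathsf{TSPD}(\{x,y\})=2\|x-y\|_T$ for $x\ne y$. A straight ring is a ring consisting of two combined nodes connected directly by the truck with the drone on board, i.e. a ring with no drone node and no truck node.
   Formalization: False as stated (e.g. for three customers every solution has a straight ring). Added: the number of customers is not 3, and some feasible solution that is not a two-ring solution with a straight ring costs no more than every two-ring solution with a straight ring. *)

theory Defs
  imports "HOL-Analysis.Analysis" "HOL-Combinatorics.Multiset_Permutations"
begin

type_synonym point = "real ^ 2"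

definition is_norm :: "(point \<Rightarrow> real) \<Rightarrow> bool" where
  "is_norm N \<longleftrightarrow>
     (\<forall>x. N x = 0 \<longleftrightarrow> x = 0) \<and>
     (\<forall>a x. N (a *\<^sub>R x) = \<bar>a\<bar> * N x) \<and>
     (\<forall>x y. N (x + y) \<le> N x + N y)"

fun path_length :: "(point \<Rightarrow> real) \<Rightarrow> point list \<Rightarrow> real" where
  "path_length N (x # y # ps) = N (y - x) + path_length N (y # ps)"
| "path_length N _ = 0"

text \<open>The order in which the truck visits its nodes is not part of a ring; it is optimised in the
  ring's cost. A ring is oriented in the direction in which the tour runs through it.\<close>

datatype ring =
  Ring (ring_start: point) (ring_end: point) (drone_node: "point option") (truck_nodes: "point set")

definition inner_nodes :: "ring \<Rightarrow> point set" where
  "inner_nodes r = set_option (drone_node r) \<union> truck_nodes r"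

definition valid_ring :: "ring \<Rightarrow> bool" where
  "valid_ring r \<longleftrightarrow>
     ring_start r \<noteq> ring_end r \<and>
     finite (truck_nodes r) \<and>
     set_option (drone_node r) \<inter> truck_nodes r = {} \<and>
     ring_start r \<notin> inner_nodes r \<and> ring_end r \<notin> inner_nodes r"

definition straight_ring :: "ring \<Rightarrow> bool" where
  "straight_ring r \<longleftrightarrow> drone_node r = None \<and> truck_nodes r = {}"

definition ring_cost :: "(point \<Rightarrow> real) \<Rightarrow> (point \<Rightarrow> real) \<Rightarrow> ring \<Rightarrow> real" where
  "ring_cost T D r =
     Min ((\<lambda>xs. let t = path_length T (ring_start r # xs @ [ring_end r]) in
             case drone_node r of
               None \<Rightarrow> t
             | Some d \<Rightarrow> max t (path_length D [ring_start r, d, ring_end r]))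
          ` permutations_of_set (truck_nodes r))"

text \<open>The list gives the cyclic order of the rings. The combined nodes are the start nodes of the
  rings, each of which is also the end node of the preceding ring.\<close>

definition cyclic_tour :: "point set \<Rightarrow> ring list \<Rightarrow> bool" where
  "cyclic_tour X rs \<longleftrightarrow>
     rs \<noteq> [] \<and>
     (\<forall>r \<in> set rs. valid_ring r) \<and>
     (\<forall>i < length rs. ring_end (rs ! i) = ring_start (rs ! (Suc i mod length rs))) \<and>
     distinct (map ring_start rs) \<and>
     (\<forall>i < length rs. \<forall>j < length rs. i \<noteq> j \<longrightarrow>
        inner_nodes (rs ! i) \<inter> inner_nodes (rs ! j) = {}) \<and>
     ring_start ` set rs \<inter> (\<Union>r \<in> set rs. inner_nodes r) = {} \<and>
     ring_start ` set rs \<union> (\<Union>r \<in> set rs. inner_nodes r) = X"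

text \<open>At most one customer: nothing to do, cost zero. For two customers the only cyclic tours
  consist of two straight rings, so that case needs no convention of its own.\<close>

definition feasible :: "point set \<Rightarrow> ring list \<Rightarrow> bool" where
  "feasible X rs \<longleftrightarrow> (if card X \<le> 1 then rs = [] else cyclic_tour X rs)"

definition makespan :: "(point \<Rightarrow> real) \<Rightarrow> (point \<Rightarrow> real) \<Rightarrow> ring list \<Rightarrow> real" where
  "makespan T D rs = (\<Sum>r \<leftarrow> rs. ring_cost T D r)"

definition tspd :: "(point \<Rightarrow> real) \<Rightarrow> (point \<Rightarrow> real) \<Rightarrow> point set \<Rightarrow> real" where
  "tspd T D X = (INF rs \<in> {rs. feasible X rs}. makespan T D rs)"

definition optimal :: "(point \<Rightarrow> real) \<Rightarrow> (point \<Rightarrow> real) \<Rightarrow> point set \<Rightarrow> ring list \<Rightarrow> bool" where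
  "optimal T D X rs \<longleftrightarrow> feasible X rs \<and> makespan T D rs = tspd T D X"

text \<open>A straight ring is removed by merging it with an adjacent ring. In a tour with only two rings
  the merged ring would have equal start and end nodes, which is not a ring, and the straight ring
  can then be unavoidable, for any number of customers: let both norms be the same, two customers
  be close to the origin, one at (-1, 0) and all others close to (1, 0). Making the first two the
  combined nodes, joined by a straight ring, the drone serves (-1, 0) while the truck visits the
  others, at a total cost of about 2; every tour without straight rings costs about 4 or more.\<close>

definition degenerate_tour :: "ring list \<Rightarrow> bool" where
  "degenerate_tour rs \<longleftrightarrow> length rs = 2 \<and> (\<exists>r \<in> set rs. straight_ring r)"

end

theory Submission
  imports Defs
begin

text \<open>There are finitely many tours, so some non-degenerate tour is optimal. A straight ring from
  \<open>a\<close> to \<open>b\<close> can be merged with the next ring, \<open>b\<close> becoming its first truck node: the truck drives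
  the same route, and by the triangle inequality and \<open>D \<le> T\<close> the drone, now starting at \<open>a\<close>, loses
  at most the length of the straight ring. This needs three rings, and it may produce a degenerate
  tour only if there are exactly three. In that case one merges two straight rings if there are
  two; all three are straight only for three customers.\<close>

section \<open>Cyclic tours without indices\<close>

abbreviation joins :: "ring \<Rightarrow> ring \<Rightarrow> bool" where
  "joins r s \<equiv> ring_end r = ring_start s"

text \<open>Trades indices for list and set operations, which simplify under append and Cons.
  Distinct start nodes make the list itself distinct, so different positions hold different rings
  and \<open>pairwise\<close> on the set suffices.\<close>

lemma cyclic_tour_iff:
  "cyclic_tour X rs \<longleftrightarrow>
     rs \<noteq> [] \<and>
     (\<forall>r \<in> set rs. valid_ring r) \<and>
     successively joins (rs @ [hd rs]) \<and>
     distinct (map ring_start rs) \<and>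
     pairwise (\<lambda>r s. inner_nodes r \<inter> inner_nodes s = {}) (set rs) \<and>
     ring_start ` set rs \<inter> (\<Union>r \<in> set rs. inner_nodes r) = {} \<and>
     ring_start ` set rs \<union> (\<Union>r \<in> set rs. inner_nodes r) = X"
proof -
  have chain: "(\<forall>i < length rs. ring_end (rs ! i) = ring_start (rs ! (Suc i mod length rs)))
      \<longleftrightarrow> successively joins (rs @ [hd rs])" if "rs \<noteq> []"
  proof -
    \<comment> \<open>The appended head plays the role of the wrap-around modulo the length at the
      last position.\<close>
    have "(rs @ [hd rs]) ! Suc i = rs ! (Suc i mod length rs)" if "i < length rs" for i
      using that \<open>rs \<noteq> []\<close> by (cases "Suc i = length rs") (auto simp: nth_append hd_conv_nth)
    then show ?thesis
      by (auto simp: successively_conv_nth nth_append)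
  qed
  have disjoint: "(\<forall>i < length rs. \<forall>j < length rs. i \<noteq> j \<longrightarrow>
        inner_nodes (rs ! i) \<inter> inner_nodes (rs ! j) = {})
      \<longleftrightarrow> pairwise (\<lambda>r s. inner_nodes r \<inter> inner_nodes s = {}) (set rs)" (is "?L \<longleftrightarrow> ?R")
    if "distinct (map ring_start rs)"
  proof -
    from that have "distinct rs" by (simp add: distinct_map)
    show ?thesis
    proof
      assume ?L
      show ?R
      proof (rule pairwiseI)
        fix r s assume "r \<in> set rs" "s \<in> set rs" "r \<noteq> s"
        then obtain i j where "i < length rs" "j < length rs" "r = rs ! i" "s = rs ! j"
          unfolding in_set_conv_nth by blast
        with \<open>?L\<close> \<open>r \<noteq> s\<close> show "inner_nodes r \<inter> inner_nodes s = {}" by blast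
      qed
    next
      assume ?R
      then show ?L
        using \<open>distinct rs\<close> by (simp add: pairwise_def nth_eq_iff_index_eq)
    qed
  qed
  show ?thesis
    unfolding cyclic_tour_def by (intro conj_cong refl chain disjoint)
qed

text \<open>Allows a chosen straight ring to be brought to the front, where the merging lemmas
  apply.\<close>

lemma cyclic_tour_rotate:
  assumes "cyclic_tour X (us @ vs)"
  shows "cyclic_tour X (vs @ us)"
proof (cases "us = [] \<or> vs = []")
  case True
  with assms show ?thesis by auto
next
  case False
  with assms show ?thesis
    by (auto simp: cyclic_tour_iff successively_append_iff Un_commute)
qed

lemma makespan_append: "makespan T D (us @ vs) = makespan T D us + makespan T D vs"
  by (simp add: makespan_def)

text \<open>A lone ring would have to end at its own start node, which \<open>valid_ring\<close>
  forbids.\<close>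

lemma cyclic_tour_length:
  assumes "cyclic_tour X rs"
  shows "2 \<le> length rs"
proof (rule ccontr)
  assume "\<not> 2 \<le> length rs"
  moreover have "rs \<noteq> []"
    using assms by (simp add: cyclic_tour_def)
  ultimately obtain r where "rs = [r]"
    by (cases rs rule: remdups_adj.cases) auto
  with assms show False by (auto simp: cyclic_tour_iff valid_ring_def)
qed

section \<open>Merging a straight ring into its successor\<close>

definition merge :: "ring \<Rightarrow> ring \<Rightarrow> ring" where
  "merge r s = Ring (ring_start r) (ring_end s) (drone_node s) (insert (ring_start s) (truck_nodes s))"

lemma merge_sel [simp]:
  "ring_start (merge r s) = ring_start r"
  "ring_end (merge r s) = ring_end s"
  "inner_nodes (merge r s) = insert (ring_start s) (inner_nodes s)"
  by (auto simp: merge_def inner_nodes_def)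

lemma not_straight_merge: "\<not> straight_ring (merge r s)"
  by (simp add: merge_def straight_ring_def)

text \<open>The start of \<open>s\<close> turns from a combined node into an inner node, so the
  covered set is unchanged; the inner nodes of \<open>r\<close>, which \<open>merge\<close> drops,
  are none.\<close>

lemma cyclic_tour_merge:
  assumes tour: "cyclic_tour X (r # s # rs)" and "straight_ring r" and "rs \<noteq> []"
  shows "cyclic_tour X (merge r s # rs)"
proof -
  obtain q qs where rs: "rs = q # qs" using \<open>rs \<noteq> []\<close> by (cases rs) auto
  have "inner_nodes r = {}"
    using \<open>straight_ring r\<close> by (simp add: straight_ring_def inner_nodes_def)
  have valid: "valid_ring (merge r s)"
  proof -
    \<comment> \<open>A third ring \<open>q\<close> keeps the two ends of the merged ring apart, as
      start nodes are distinct.\<close>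
    have "ring_end s = ring_start q" "ring_start q \<noteq> ring_start r"
      using tour by (auto simp: cyclic_tour_iff rs)
    then show ?thesis
      using tour by (auto simp: valid_ring_def cyclic_tour_iff merge_def inner_nodes_def)
  qed
  have disjoint: "pairwise (\<lambda>r s. inner_nodes r \<inter> inner_nodes s = {}) (set (merge r s # rs))"
  proof -
    \<comment> \<open>\<open>pairwise\<close> compares only different rings, so this gives
      disjointness of \<open>s\<close> from each ring of \<open>rs\<close>.\<close>
    have "s \<notin> set rs"
      using tour by (auto simp: cyclic_tour_iff)
    then show ?thesis
      using tour by (fastforce simp: cyclic_tour_iff pairwise_insert)
  qed
  have "successively joins ((q # qs) @ [r])"
    using tour by (simp add: cyclic_tour_iff rs)
  \<comment> \<open>As last element \<open>r\<close> matters only through its start node, which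
    \<open>merge\<close> keeps.\<close>
  then have "successively joins ((q # qs) @ [merge r s])"
    by (simp only: successively_append_iff) simp
  then show ?thesis
    using tour valid disjoint \<open>inner_nodes r = {}\<close>
    by (auto simp: cyclic_tour_iff rs)
qed

text \<open>The quantity minimised in \<open>ring_cost\<close>, for one fixed truck order
  \<open>xs\<close>.\<close>

definition route_cost :: "(point \<Rightarrow> real) \<Rightarrow> (point \<Rightarrow> real) \<Rightarrow> ring \<Rightarrow> point list \<Rightarrow> real" where
  "route_cost T D r xs =
     (let t = path_length T (ring_start r # xs @ [ring_end r]) in
        case drone_node r of
          None \<Rightarrow> t
        | Some d \<Rightarrow> max t (path_length D [ring_start r, d, ring_end r]))"

lemma ring_cost_le_route_cost:
  assumes "xs \<in> permutations_of_set (truck_nodes r)"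
  shows "ring_cost T D r \<le> route_cost T D r xs"
  using assms unfolding ring_cost_def route_cost_def by (intro Min_le) auto

lemma ring_cost_attained:
  assumes "finite (truck_nodes r)"
  obtains xs where "xs \<in> permutations_of_set (truck_nodes r)"
    and "ring_cost T D r = route_cost T D r xs"
proof -
  have "ring_cost T D r \<in> route_cost T D r ` permutations_of_set (truck_nodes r)"
    unfolding ring_cost_def route_cost_def
    \<comment> \<open>\<open>permutations_of_set\<close> is empty for an infinite set; finiteness
      makes the minimum one over a finite nonempty set.\<close>
    by (intro Min_in) (use assms in auto)
  then show ?thesis using that by blast
qed

lemma ring_cost_straight:
  assumes "straight_ring r"
  shows "ring_cost T D r = T (ring_end r - ring_start r)"
  using assms by (simp add: straight_ring_def ring_cost_def)

lemma ring_cost_merge_le: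
  assumes "is_norm D" and DT: "\<And>p. D p \<le> T p"
    and "straight_ring r" and "valid_ring s" and "joins r s"
  shows "ring_cost T D (merge r s) \<le> ring_cost T D r + ring_cost T D s"
proof -
  let ?a = "ring_start r" and ?b = "ring_start s" and ?c = "ring_end s"
  obtain xs where xs: "xs \<in> permutations_of_set (truck_nodes s)"
    and cost: "ring_cost T D s = route_cost T D s xs"
    using \<open>valid_ring s\<close> ring_cost_attained unfolding valid_ring_def by blast
  \<comment> \<open>Prefixing the former combined node to an optimal order for \<open>s\<close>
    gives a candidate order for the merged ring.\<close>
  have "?b # xs \<in> permutations_of_set (truck_nodes (merge r s))"
    using xs \<open>valid_ring s\<close>
    by (auto simp: merge_def valid_ring_def inner_nodes_def permutations_of_set_def)
  then have "ring_cost T D (merge r s) \<le> route_cost T D (merge r s) (?b # xs)"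
    by (rule ring_cost_le_route_cost)
  also have "\<dots> \<le> T (?b - ?a) + route_cost T D s xs"
  proof -
    have "D (d - ?a) \<le> T (?b - ?a) + D (d - ?b)" for d
    proof -
      have "D ((?b - ?a) + (d - ?b)) \<le> D (?b - ?a) + D (d - ?b)"
        using \<open>is_norm D\<close> unfolding is_norm_def by blast
      then show ?thesis using DT[of "?b - ?a"] by simp
    qed
    \<comment> \<open>The truck route grows by exactly \<open>T (?b - ?a)\<close> and the drone
      route by at most that, hence so does their maximum.\<close>
    then show ?thesis
      by (auto simp: route_cost_def merge_def Let_def add.assoc split: option.split)
        (smt (verit, best))
  qed
  finally show ?thesis
    using cost \<open>straight_ring r\<close> \<open>joins r s\<close> by (simp add: ring_cost_straight)
qed

lemma makespan_merge_le:
  assumes "is_norm D" and "\<And>p. D p \<le> T p"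
    and "cyclic_tour X (r # s # rs)" and "straight_ring r"
  shows "makespan T D (merge r s # rs) \<le> makespan T D (r # s # rs)"
proof -
  have "valid_ring s" "joins r s"
    using assms(3) by (auto simp: cyclic_tour_iff)
  then show ?thesis
    using ring_cost_merge_le[OF assms(1,2,4)] by (simp add: makespan_def)
qed

section \<open>Removing all straight rings\<close>

lemma shorten_tour:
  assumes "is_norm D" and "\<And>p. D p \<le> T p" and "card X \<noteq> 3"
    and tour: "cyclic_tour X rs" and "\<not> degenerate_tour rs"
    and "r \<in> set rs" and "straight_ring r"
  obtains rs' where "cyclic_tour X rs'" and "\<not> degenerate_tour rs'"
    and "makespan T D rs' \<le> makespan T D rs" and "length rs' < length rs"
proof -
  obtain us vs where rs: "rs = us @ r # vs"
    using \<open>r \<in> set rs\<close> by (meson split_list)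
  have "length rs \<noteq> 2"
    using assms(5-7) by (auto simp: degenerate_tour_def)
  then have "3 \<le> length rs"
    using cyclic_tour_length[OF tour] by simp
  then obtain s q qs where vu: "vs @ us = s # q # qs"
    by (cases "vs @ us" rule: remdups_adj.cases) (auto simp: rs dest: arg_cong[of _ _ length])
  have tour1: "cyclic_tour X (r # s # q # qs)"
    using cyclic_tour_rotate[of X us "r # vs"] tour vu by (simp add: rs)
  have mk: "makespan T D rs = makespan T D (r # s # q # qs)"
    using vu makespan_append[of T D "r # vs" us] by (simp add: rs makespan_append)
  have len: "length rs = length qs + 3"
    using arg_cong[OF vu, of length] by (simp add: rs)
  show thesis
  \<comment> \<open>Exactly in this case would merging \<open>r\<close> with \<open>s\<close> leave
    a degenerate tour: two rings, with \<open>q\<close> straight.\<close>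
  proof (cases "qs = [] \<and> straight_ring q")
    case False
    have "\<not> degenerate_tour (merge r s # q # qs)"
      using False by (auto simp: degenerate_tour_def not_straight_merge)
    moreover have "cyclic_tour X (merge r s # q # qs)"
      using tour1 \<open>straight_ring r\<close> by (intro cyclic_tour_merge) auto
    moreover have "makespan T D (merge r s # q # qs) \<le> makespan T D rs"
      using makespan_merge_le[OF assms(1,2) tour1 \<open>straight_ring r\<close>] mk by simp
    ultimately show thesis
      using that len by simp
  next
    case True
    \<comment> \<open>The tour is \<open>[r, s, q]\<close> with \<open>r\<close> and
      \<open>q\<close> straight. Rotated, it allows merging \<open>q\<close> with \<open>r\<close>,
      which leaves \<open>s\<close> as the only possibly straight ring.\<close>
    have tour2: "cyclic_tour X [q, r, s]"
      using cyclic_tour_rotate[of X "[r, s]" "[q]"] tour1 True by simp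
    have "\<not> straight_ring s"
    proof
      assume "straight_ring s"
      \<comment> \<open>With three straight rings there are only the combined nodes, which are three
        distinct points.\<close>
      then have "X = {ring_start r, ring_start s, ring_start q}"
        using tour1 True \<open>straight_ring r\<close>
        by (auto simp: cyclic_tour_iff straight_ring_def inner_nodes_def)
      then show False
        using tour1 \<open>card X \<noteq> 3\<close> by (auto simp: cyclic_tour_iff)
    qed
    then have "\<not> degenerate_tour [merge q r, s]"
      by (simp add: degenerate_tour_def not_straight_merge)
    moreover have "cyclic_tour X [merge q r, s]"
      using tour2 True by (intro cyclic_tour_merge) auto
    moreover have "makespan T D [merge q r, s] \<le> makespan T D rs"
      using makespan_merge_le[OF assms(1,2) tour2] True mk by (simp add: makespan_def)
    ultimately show thesis
      using that len by simp
  qed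
qed

text \<open>Each merge shortens the list and preserves non-degeneracy, so merging can continue until
  no straight ring is left.\<close>

lemma tour_without_straight_rings:
  assumes "is_norm D" and "\<And>p. D p \<le> T p" and "card X \<noteq> 3"
    and "cyclic_tour X rs" and "\<not> degenerate_tour rs"
  shows "\<exists>rs'. cyclic_tour X rs' \<and> makespan T D rs' \<le> makespan T D rs \<and>
           (\<forall>r \<in> set rs'. \<not> straight_ring r)"
  using assms(4,5)
proof (induction "length rs" arbitrary: rs rule: less_induct)
  case less
  show ?case
  proof (cases "\<exists>r \<in> set rs. straight_ring r")
    case True
    then obtain rs' where "cyclic_tour X rs'" "\<not> degenerate_tour rs'"
      "makespan T D rs' \<le> makespan T D rs" "length rs' < length rs"
      using shorten_tour[OF assms(1-3) less.prems] by blast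
    then show ?thesis
      using less.hyps by (meson order_trans)
  qed (use less.prems in blast)
qed

section \<open>Existence of an optimal tour\<close>

lemma finite_feasible:
  assumes "finite X"
  shows "finite {rs. feasible X rs}"
proof -
  let ?F = "(\<lambda>(a, b, d, A). Ring a b d A) ` (X \<times> X \<times> insert None (Some ` X) \<times> Pow X)"
  have "set rs \<subseteq> ?F \<and> distinct rs" if tour: "cyclic_tour X rs" for rs
  proof (intro conjI subsetI)
    fix r assume r: "r \<in> set rs"
    then have nodes: "ring_start r \<in> X" "inner_nodes r \<subseteq> X"
      using tour by (auto simp: cyclic_tour_iff)
    obtain i where i: "i < length rs" "r = rs ! i"
      using r by (metis in_set_conv_nth)
    \<comment> \<open>The end node lies in \<open>X\<close> because it is the start node of the next
      ring.\<close>
    then have "Suc i mod length rs < length rs" by (intro mod_less_divisor) auto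
    moreover from i tour have "ring_end r = ring_start (rs ! (Suc i mod length rs))"
      by (simp add: cyclic_tour_def)
    ultimately have "ring_end r \<in> X"
      using tour by (auto simp: cyclic_tour_iff)
    with nodes show "r \<in> ?F"
      by (cases r; cases "drone_node r") (auto simp: inner_nodes_def image_iff)
  next
    show "distinct rs"
      using tour by (simp add: cyclic_tour_iff distinct_map)
  qed
  \<comment> \<open>The extra \<open>[]\<close> is the feasible solution for at most one
    customer.\<close>
  then have "{rs. feasible X rs} \<subseteq> insert [] {rs. set rs \<subseteq> ?F \<and> distinct rs}"
    by (auto simp: feasible_def split: if_splits)
  moreover have "finite {rs. set rs \<subseteq> ?F \<and> distinct rs}"
    by (rule finite_subset_distinct) (use assms in auto)
  ultimately show ?thesis
    using finite_subset by blast
qed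

lemma optimalI:
  assumes "feasible X rs" and "\<And>rs'. feasible X rs' \<Longrightarrow> makespan T D rs \<le> makespan T D rs'"
  shows "optimal T D X rs"
proof -
  have "tspd T D X = makespan T D rs"
    unfolding tspd_def using assms by (intro cInf_eq_minimum) auto
  then show ?thesis
    using assms(1) by (simp add: optimal_def)
qed

theorem theorem4:
  fixes T D :: "real ^ 2 \<Rightarrow> real" and X :: "(real ^ 2) set"
  assumes "is_norm T" and "is_norm D"
    and "\<And>p. D p \<le> T p"
    and "finite X"
    and "card X \<noteq> 3"
    and "\<exists>rs. feasible X rs \<and> \<not> degenerate_tour rs \<and>
           (\<forall>rs'. feasible X rs' \<and> degenerate_tour rs' \<longrightarrow> makespan T D rs \<le> makespan T D rs')"
  shows "\<exists>rs. optimal T D X rs \<and> (\<forall>r \<in> set rs. \<not> straight_ring r)"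
proof (cases "card X \<le> 1")
  case True
  then have "optimal T D X []"
    by (intro optimalI) (auto simp: feasible_def)
  then show ?thesis by (intro exI[of _ "[]"]) simp
next
  case False
  obtain rs0 where rs0: "feasible X rs0" "\<not> degenerate_tour rs0"
    and better: "\<And>rs'. feasible X rs' \<Longrightarrow> degenerate_tour rs' \<Longrightarrow> makespan T D rs0 \<le> makespan T D rs'"
    using assms(6) by blast
  let ?N = "{rs. feasible X rs \<and> \<not> degenerate_tour rs}"
  have "finite ?N" "?N \<noteq> {}"
    using finite_feasible[OF \<open>finite X\<close>] rs0 by auto
  then obtain rs1 where rs1: "rs1 \<in> ?N"
    and least: "\<And>rs. rs \<in> ?N \<Longrightarrow> makespan T D rs1 \<le> makespan T D rs"
    using ex_min_if_finite[of "makespan T D ` ?N"] by (auto simp: not_less)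
  \<comment> \<open>Degenerate tours are compared with \<open>rs1\<close> through
    \<open>rs0\<close>, which is itself a member of \<open>?N\<close>.\<close>
  have minimal: "makespan T D rs1 \<le> makespan T D rs" if "feasible X rs" for rs
    using that least[of rs] least[of rs0] better[of rs] rs0 by force
  obtain rs2 where "cyclic_tour X rs2" "makespan T D rs2 \<le> makespan T D rs1"
    "\<forall>r \<in> set rs2. \<not> straight_ring r"
    using tour_without_straight_rings[OF assms(2,3,5), of rs1] rs1 False
    by (auto simp: feasible_def)
  then show ?thesis
    using minimal False by (intro exI[of _ rs2] conjI optimalI) (auto simp: feasible_def intro: order_trans)
qed

end
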